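(* Let $n\ge 1$ and $d\ge 2$ be integers and let $A$ be a $d$-dimensional $(0,1)$-matrix of order $n$. For $i\in\{1,\dots,n\}$ and $k\in\{1,\dots,d-1\}$ let $s_{i,k}$ be nonnegative integers such that for every $i\in\{1,\dots,n\}$: (1) for every $k$ with $2\le k\le d-1$ and every plane $P\in L^k_i(A)$, all ones of $A$ lying in $P$ can be covered by $s_{i,k}$ planes from $L^{k-1}_i(A)$ (for $k=d-1$ the only plane in $L^{d-1}_i(A)$ is the $i$-th hyperplane of $A$); (2) every $1$-dimensional plane from $L^1_i(A)$ contains at most $s_{i,1}$ ones. Then $$\operatorname{per} A \leq \prod_{k=1}^{d-1}\prod_{i=1}^n (s_{i,k}!)^{1/s_{i,k}},$$ where for $s_{i,k}=0$ the expression $(s_{i,k}!)^{1/s_{i,k}}$ is read as $0$.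
   Context: Let $I_n^d=\{(\alpha_1,\dots,\alpha_d):\alpha_i\in\{1,\dots,n\}\}$. A $d$-dimensional matrix $A$ of order $n$ is a real array $(a_\alpha)_{\alpha\in I_n^d}$; it is a $(0,1)$-matrix if every entry is $0$ or $1$. A $k$-dimensional plane in $A$ is the set of entries obtained by fixing $d-k$ of the indices and letting the other $k$ vary from $1$ to $n$; a $(d-1)$-dimensional plane is a hyperplane. $L^k_i(A)$ denotes the set of $k$-dimensional planes in $A$ in which the last $k$ indices vary, the first $d-k$ indices are fixed, and the very first index equals $i$. The $i$-th hyperplane of $A$ is the set of entries whose first index equals $i$. A diagonal of $A$ is a set of $n$ indices $\{\alpha^1,\dots,\alpha^n\}\subset I_n^d$ such that any two distinct ones differ in all $d$ positions (Hamming distance $d$). The permanent of $A$ is $\operatorname{per}A=\sum_{p}\prod_{\alpha\in p}a_\alpha$, the sum over all diagonals $p$ of $A$. *)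

theory Defs
  imports Complex_Main "HOL-Library.FuncSet"
begin

text \<open>
  A multi-index is an extensional function on \<open>{1..d}\<close>, so that \<open>multi_indices n d\<close> is finite, has
  \<open>n ^ d\<close> elements, and two multi-indices are equal iff they agree on all \<open>d\<close> positions.
  A \<open>d\<close>-dimensional matrix of order \<open>n\<close> is a function of type \<open>(nat \<Rightarrow> nat) \<Rightarrow> real\<close>, of which
  only the values on \<open>multi_indices n d\<close> are relevant.
\<close>

definition multi_indices :: "nat \<Rightarrow> nat \<Rightarrow> (nat \<Rightarrow> nat) set" where
  "multi_indices n d = {1..d} \<rightarrow>\<^sub>E {1..n}"

definition zero_one_matrix :: "nat \<Rightarrow> nat \<Rightarrow> ((nat \<Rightarrow> nat) \<Rightarrow> real) \<Rightarrow> bool" where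
  "zero_one_matrix n d A \<longleftrightarrow> (\<forall>\<alpha>\<in>multi_indices n d. A \<alpha> = 0 \<or> A \<alpha> = 1)"

text \<open>
  A plane is represented by the set of positions of its entries. Fixing the indices at the positions
  \<open>F \<subseteq> {1..d}\<close> to the values given by \<open>\<beta>\<close> yields a plane of dimension \<open>d - card F\<close>.
\<close>

definition plane :: "nat \<Rightarrow> nat \<Rightarrow> nat set \<Rightarrow> (nat \<Rightarrow> nat) \<Rightarrow> (nat \<Rightarrow> nat) set" where
  "plane n d F \<beta> = {\<alpha> \<in> multi_indices n d. \<forall>j\<in>F. \<alpha> j = \<beta> j}"

text \<open>The set \<open>L\<^sup>k\<^sub>i\<close>; it is only meant for \<open>1 \<le> k \<le> d - 1\<close>, where position \<open>1\<close> is among the fixed ones.\<close>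

definition last_planes :: "nat \<Rightarrow> nat \<Rightarrow> nat \<Rightarrow> nat \<Rightarrow> (nat \<Rightarrow> nat) set set" where
  "last_planes n d k i = {plane n d {1..d - k} \<beta> | \<beta>. \<beta> \<in> multi_indices n d \<and> \<beta> 1 = i}"

definition ones_in :: "((nat \<Rightarrow> nat) \<Rightarrow> real) \<Rightarrow> (nat \<Rightarrow> nat) set \<Rightarrow> (nat \<Rightarrow> nat) set" where
  "ones_in A P = {\<alpha> \<in> P. A \<alpha> = 1}"

text \<open>
  A covering by \<open>s\<close> planes need not consist of distinct planes, hence \<open>card \<C> \<le> s\<close> below.
\<close>

definition coverable_by :: "nat \<Rightarrow> 'a set set \<Rightarrow> 'a set \<Rightarrow> bool" where
  "coverable_by s \<L> X \<longleftrightarrow> (\<exists>\<C>. \<C> \<subseteq> \<L> \<and> finite \<C> \<and> card \<C> \<le> s \<and> X \<subseteq> \<Union>\<C>)"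

definition diagonals :: "nat \<Rightarrow> nat \<Rightarrow> (nat \<Rightarrow> nat) set set" where
  "diagonals n d = {p. p \<subseteq> multi_indices n d \<and> card p = n \<and>
     (\<forall>\<alpha>\<in>p. \<forall>\<beta>\<in>p. \<alpha> \<noteq> \<beta> \<longrightarrow> (\<forall>j\<in>{1..d}. \<alpha> j \<noteq> \<beta> j))}"

definition permanent :: "nat \<Rightarrow> nat \<Rightarrow> ((nat \<Rightarrow> nat) \<Rightarrow> real) \<Rightarrow> real" where
  "permanent n d A = (\<Sum>p\<in>diagonals n d. \<Prod>\<alpha>\<in>p. A \<alpha>)"

text \<open>
  The number \<open>(s!)\<^bsup>1/s\<^esup>\<close>. The case distinction is needed because division by zero would
  make the second branch \<open>1\<close> for \<open>s = 0\<close>, whereas the convention is \<open>0\<close>.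
\<close>

definition fact_root :: "nat \<Rightarrow> real" where
  "fact_root s = (if s = 0 then 0 else fact s powr (1 / real s))"

end

theory Submission
  imports Defs
begin

text \<open>
  A diagonal is given by \<open>d - 1\<close> permutations, the \<open>j\<close>-th of which sends \<open>i\<close> to the \<open>j\<close>-th index of the
  element of the diagonal in hyperplane \<open>i\<close>. Once the permutations for the indices up to \<open>m\<close> are chosen,
  the covering hypothesis leaves at most \<open>s\<^bsub>i,d-m\<^esub>\<close> values for index \<open>m + 1\<close> in hyperplane \<open>i\<close>, so
  Bregman's theorem bounds the number of choices for the next permutation.
  Bregman's theorem itself is proved by Schrijver's convexity argument, written additively with
  logarithms.
\<close>

section \<open>The numbers \<open>(s!)\<^bsup>1/s\<^esup>\<close>\<close>

lemma fact_root_nonneg: "0 \<le> fact_root s"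
  by (simp add: fact_root_def)

lemma fact_root_pos: "0 < s \<Longrightarrow> 0 < fact_root s"
  by (simp add: fact_root_def)

text \<open>True at s = 0 as well, where \<open>ln 0 = 0\<close> and division by 0 make both sides
  0.\<close>

lemma ln_fact_root: "ln (fact_root s) = ln (fact s) / real s"
  by (simp add: fact_root_def ln_powr)

text \<open>On the logarithmic scale this is the mean of ln 1, ..., ln s, and the next term ln (s +
  1) is at least that mean. Monotonicity later turns upper bounds on row sizes into upper bounds on
  Bregman's product.\<close>

lemma mono_fact_root: "mono fact_root"
  unfolding mono_iff_le_Suc
proof
  fix s
  show "fact_root s \<le> fact_root (Suc s)"
  proof (cases "s = 0")
    case True
    then show ?thesis by (simp add: fact_root_def)
  next
    case False
    have "fact s \<le> (real s) ^ s"
      using fact_le_power[of s, where ?'a = real] by simp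
    also have "\<dots> \<le> real (Suc s) ^ s"
      by (intro power_mono) auto
    finally have "ln (fact s) \<le> ln (real (Suc s) ^ s)"
      by (subst ln_le_cancel_iff) auto
    also have "\<dots> = real s * ln (real (Suc s))"
      by (simp add: ln_realpow)
    finally have a: "ln (fact s) \<le> real s * ln (real (Suc s))" .
    have "ln (fact (Suc s) :: real) = ln (real (Suc s)) + ln (fact s)"
      by (simp add: ln_mult del: of_nat_Suc)
    then have "ln (fact s) / real s \<le> ln (fact (Suc s)) / real (Suc s)"
      using a False by (simp add: field_simps)
    then have "ln (fact_root s) \<le> ln (fact_root (Suc s))"
      by (simp only: ln_fact_root)
    then show ?thesis
      using False by (simp add: fact_root_pos)
  qed
qed

text \<open>The logarithm of r! = r * (r - 1)!; at r = 1 the second summand is 0.\<close>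

lemma ln_add_pred_mult_ln_fact_root:
  assumes "0 < r"
  shows "ln (real r) + real (r - 1) * ln (fact_root (r - 1)) = real r * ln (fact_root r)"
proof -
  obtain q where q: "r = Suc q" using assms by (cases r) auto
  have "ln (fact r :: real) = ln (real r) + ln (fact q)"
    by (simp add: q ln_mult del: of_nat_Suc)
  then show ?thesis by (simp add: q ln_fact_root del: of_nat_Suc)
qed

section \<open>Bregman's theorem\<close>

text \<open>Junk value: summands with \<open>t k = 0\<close> vanish, as \<open>ln 0 = 0\<close> in HOL.\<close>

lemma sum_mult_ln_ge:
  fixes t :: "'a \<Rightarrow> real"
  assumes "finite K" and nonneg: "\<And>k. k \<in> K \<Longrightarrow> 0 \<le> t k" and pos: "0 < sum t K"
  shows "sum t K * ln (sum t K / real (card K)) \<le> (\<Sum>k\<in>K. t k * ln (t k))"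
proof -
  define c where "c = sum t K / real (card K)"
  have "card K > 0" using assms by (auto simp: card_gt_0_iff)
  then have c: "c > 0" "real (card K) * c = sum t K"
    using pos by (auto simp: c_def)
  \<comment> \<open>The tangent of x ln x at the mean c lies below the graph. Summed over
    \<open>K\<close>, the terms \<open>t k - c\<close> cancel.\<close>
  have "t k * ln c + t k - c \<le> t k * ln (t k)" if "k \<in> K" for k
  proof (cases "t k = 0")
    case False
    then have t: "t k > 0" using nonneg[OF that] by simp
    have "t k * ln (c / t k) \<le> t k * (c / t k - 1)"
      using t c ln_le_minus_one by (intro mult_left_mono) auto
    also have "\<dots> = c - t k" using t by (simp add: field_simps)
    finally show ?thesis using t c by (simp add: ln_div right_diff_distrib)
  qed (use c in simp)
  then have "(\<Sum>k\<in>K. t k * ln c + t k - c) \<le> (\<Sum>k\<in>K. t k * ln (t k))"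
    by (rule sum_mono)
  moreover have "(\<Sum>k\<in>K. t k * ln c + t k - c) = sum t K * ln c"
    using c by (simp add: sum.distrib sum_subtractf sum_distrib_right)
  ultimately show ?thesis by (simp add: c_def)
qed

text \<open>For finite \<open>I\<close> and \<open>J\<close> of equal size, these are the perfect
  matchings counted by the permanent of the (0,1)-matrix with row supports \<open>S i\<close>.
  Arbitrary index sets allow an induction that deletes a row and a column.\<close>

definition bijections_within :: "'a set \<Rightarrow> 'b set \<Rightarrow> ('a \<Rightarrow> 'b set) \<Rightarrow> ('a \<Rightarrow> 'b) set" where
  "bijections_within I J S = {f \<in> extensional I. bij_betw f I J \<and> (\<forall>i\<in>I. f i \<in> S i)}"

lemma finite_bijections_within:
  assumes "finite I" "finite J"
  shows "finite (bijections_within I J S)"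
proof (rule finite_subset)
  show "bijections_within I J S \<subseteq> I \<rightarrow>\<^sub>E J"
    by (auto simp: bijections_within_def PiE_def bij_betw_def)
  show "finite (I \<rightarrow>\<^sub>E J)" using assms by (intro finite_PiE) auto
qed

text \<open>One term of the expansion along row \<open>i\<close>: a bijection with
  \<open>f i = k\<close> is determined by its restriction to the other rows, which avoids column
  \<open>k\<close> by injectivity.\<close>

lemma card_bijections_within_at_le:
  assumes "finite I" "finite J" "i \<in> I"
  shows "card {f \<in> bijections_within I J S. f i = k}
    \<le> card (bijections_within (I - {i}) (J - {k}) (\<lambda>j. S j - {k}))"
proof (rule card_inj_on_le)
  show "inj_on (\<lambda>f. restrict f (I - {i})) {f \<in> bijections_within I J S. f i = k}"
  proof (rule inj_onI)
    fix f g
    assume *: "f \<in> {f \<in> bijections_within I J S. f i = k}" "g \<in> {f \<in> bijections_within I J S. f i = k}"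
      and eq: "restrict f (I - {i}) = restrict g (I - {i})"
    show "f = g"
    proof (rule extensionalityI[of _ I])
      fix j assume "j \<in> I"
      then show "f j = g j" using * fun_cong[OF eq, of j] by (cases "j = i") auto
    qed (use * in \<open>auto simp: bijections_within_def\<close>)
  qed
  show "(\<lambda>f. restrict f (I - {i})) ` {f \<in> bijections_within I J S. f i = k}
    \<subseteq> bijections_within (I - {i}) (J - {k}) (\<lambda>j. S j - {k})"
  proof clarify
    fix f assume f: "f \<in> bijections_within I J S" and k: "k = f i"
    have bij: "bij_betw f I J" using f by (simp add: bijections_within_def)
    have "bij_betw f (I - {i}) (J - {f i})"
      using bij assms(3) by (intro bij_betw_DiffI) (auto simp: bij_betw_def)
    moreover have "f j \<noteq> f i" if "j \<in> I - {i}" for j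
      using that bij assms(3) by (auto simp: bij_betw_def inj_on_def)
    ultimately show "restrict f (I - {i}) \<in> bijections_within (I - {i}) (J - {f i}) (\<lambda>j. S j - {f i})"
      using f by (auto simp: bijections_within_def simp del: restrict_apply) auto
  qed
qed (use assms in \<open>auto intro: finite_bijections_within\<close>)

text \<open>
  The exponent count in Schrijver's argument: for a fixed row \<open>j\<close>, deleting the column \<open>f i\<close> of another
  row \<open>i\<close> shrinks row \<open>j\<close> for exactly \<open>card (S j) - 1\<close> of the \<open>i\<close>.
\<close>

lemma sum_ln_fact_root_deleted:
  assumes fin: "finite I" "finite J" and f: "f \<in> bijections_within I J S"
    and j: "j \<in> I" and S: "S j \<subseteq> J"
  shows "ln (real (card (S j))) + (\<Sum>i\<in>I - {j}. ln (fact_root (card (S j - {f i}))))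
    = real (card I) * ln (fact_root (card (S j)))"
proof -
  define r where "r = card (S j)"
  have bij: "bij_betw f I J" and fj: "f j \<in> S j"
    using f j by (auto simp: bijections_within_def)
  have finS: "finite (S j)" using S fin finite_subset by blast
  have r: "0 < r" using fj finS by (auto simp: r_def card_gt_0_iff)
  have cardJ: "card J = card I" using bij by (metis bij_betw_same_card)
  have rn: "r \<le> card I" using S fin cardJ by (metis card_mono r_def)
  have "bij_betw f (I - {j}) (J - {f j})"
    using bij j by (intro bij_betw_DiffI) (auto simp: bij_betw_def)
  then have "(\<Sum>i\<in>I - {j}. ln (fact_root (card (S j - {f i}))))
    = (\<Sum>k\<in>J - {f j}. ln (fact_root (card (S j - {k}))))"
    by (rule sum.reindex_bij_betw)
  also have "\<dots> = (\<Sum>k\<in>S j - {f j}. ln (fact_root (card (S j - {k}))))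
      + (\<Sum>k\<in>J - S j. ln (fact_root (card (S j - {k}))))"
  proof (subst sum.union_disjoint[symmetric])
    have "J - {f j} = S j - {f j} \<union> (J - S j)" using S fj by auto
    then show "(\<Sum>k\<in>J - {f j}. ln (fact_root (card (S j - {k}))))
      = (\<Sum>k\<in>S j - {f j} \<union> (J - S j). ln (fact_root (card (S j - {k}))))" by simp
  qed (use fin finS in auto)
  also have "(\<Sum>k\<in>S j - {f j}. ln (fact_root (card (S j - {k})))) = real (r - 1) * ln (fact_root (r - 1))"
    using finS fj by (simp add: r_def)
  also have "(\<Sum>k\<in>J - S j. ln (fact_root (card (S j - {k})))) = real (card I - r) * ln (fact_root r)"
    using fin finS S cardJ by (simp add: r_def card_Diff_subset)
  \<comment> \<open>Of the columns other than \<open>f j\<close>, r - 1 shrink row \<open>j\<close>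
    and \<open>card I - r\<close> leave it at size r. The term ln r lifts the former to r copies of
    \<open>ln (fact_root r)\<close>, which makes \<open>card I\<close> copies in total.\<close>
  finally show ?thesis
    using ln_add_pred_mult_ln_fact_root[OF r] rn
    by (simp add: r_def of_nat_diff algebra_simps)
qed

text \<open>Induction on the number of rows. For each row \<open>i\<close>, convexity of x ln x
  bounds P ln P by a sum over all \<open>f\<close> in \<open>F\<close>, and the induction hypothesis
  bounds the minor left by deleting row \<open>i\<close> and column \<open>f i\<close>. Summing over
  the n rows gives n P ln P on the left and, by the exponent count, n times the logarithm of the
  product for each of the P bijections on the right.\<close>

theorem Bregman:
  assumes "finite I" "finite J" "\<And>i. i \<in> I \<Longrightarrow> S i \<subseteq> J"
  shows "real (card (bijections_within I J S)) \<le> (\<Prod>i\<in>I. fact_root (card (S i)))"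
  using assms
proof (induction "card I" arbitrary: I J S)
  case 0
  then have "I = {}" by simp
  then have "bijections_within I J S \<subseteq> {\<lambda>_. undefined}"
    by (auto simp: bijections_within_def)
  from card_mono[OF _ this] show ?case using \<open>I = {}\<close> by simp
next
  case (Suc m)
  define F where "F = bijections_within I J S"
  define n where "n = card I"
  define P where "P = real (card F)"
  \<comment> \<open>\<open>P\<close> is the permanent and \<open>Q i k\<close> the part of it that
    passes through entry (i, k).\<close>
  define Q where "Q i k = real (card {f \<in> F. f i = k})" for i k
  have n: "n > 0" using Suc.hyps by (simp add: n_def)
  have Q_nonneg: "0 \<le> Q i k" for i k by (simp add: Q_def)
  have finF: "finite F" using Suc.prems by (simp add: F_def finite_bijections_within)
  have finS: "finite (S i)" if "i \<in> I" for i
    using Suc.prems that finite_subset by blast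
  show ?case
  proof (cases "F = {}")
    case True
    then show ?thesis by (simp add: F_def prod_nonneg fact_root_nonneg)
  next
    case False
    then have P: "P > 0" using finF by (simp add: P_def card_gt_0_iff)
    have S_pos: "card (S i) > 0" if "i \<in> I" for i
      using False that finS by (fastforce simp: F_def bijections_within_def card_gt_0_iff)
    have fibres: "(\<Sum>k\<in>S i. Q i k * g k) = (\<Sum>f\<in>F. g (f i))" if "i \<in> I" for i and g :: "_ \<Rightarrow> real"
    proof -
      have "(\<Sum>f\<in>F. g (f i)) = (\<Sum>k\<in>S i. \<Sum>f\<in>{f \<in> F. f i = k}. g (f i))"
        using that finF finS
        by (intro sum.group[symmetric]) (auto simp: F_def bijections_within_def)
      also have "\<dots> = (\<Sum>k\<in>S i. Q i k * g k)"
        by (intro sum.cong) (auto simp: Q_def)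
      finally show ?thesis by simp
    qed
    have row: "P * ln P \<le> (\<Sum>f\<in>F. ln (real (card (S i))) + ln (Q i (f i)))" if i: "i \<in> I" for i
    proof -
      have PQ: "(\<Sum>k\<in>S i. Q i k) = P"
        using fibres[OF i, of "\<lambda>_. 1"] by (simp add: P_def)
      have "P * ln (P / real (card (S i))) \<le> (\<Sum>k\<in>S i. Q i k * ln (Q i k))"
        using sum_mult_ln_ge[of "S i" "Q i", unfolded PQ] finS[OF i] P Q_nonneg by blast
      also have "\<dots> = (\<Sum>f\<in>F. ln (Q i (f i)))" by (rule fibres[OF i])
      finally show ?thesis
        using P S_pos[OF i] by (simp add: ln_div sum.distrib P_def[symmetric] algebra_simps)
    qed
    have minor: "ln (Q i (f i)) \<le> (\<Sum>j\<in>I - {i}. ln (fact_root (card (S j - {f i}))))"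
      if f: "f \<in> F" and i: "i \<in> I" for f i
    proof -
      have fB: "bij_betw f I J" "\<And>j. j \<in> I \<Longrightarrow> f j \<in> S j"
        using f by (auto simp: F_def bijections_within_def)
      \<comment> \<open>By injectivity \<open>f j\<close> survives in the shrunken row, so no factor
        is 0 and the logarithm of the product splits.\<close>
      have pos: "fact_root (card (S j - {f i})) > 0" if "j \<in> I - {i}" for j
      proof -
        have "f j \<in> S j - {f i}" using that fB i by (auto simp: bij_betw_def inj_on_def)
        then show ?thesis using that finS[of j] by (intro fact_root_pos) (auto simp: card_gt_0_iff)
      qed
      have "Q i (f i) > 0" using f finF by (auto simp: Q_def card_gt_0_iff)
      moreover have "Q i (f i) \<le> (\<Prod>j\<in>I - {i}. fact_root (card (S j - {f i})))"
      proof -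
        have "Q i (f i) \<le> real (card (bijections_within (I - {i}) (J - {f i}) (\<lambda>j. S j - {f i})))"
          unfolding Q_def F_def using card_bijections_within_at_le Suc.prems i by simp
        also have "\<dots> \<le> (\<Prod>j\<in>I - {i}. fact_root (card (S j - {f i})))"
          using Suc.prems Suc.hyps(2) i by (intro Suc.hyps(1)) auto
        finally show ?thesis .
      qed
      ultimately have "ln (Q i (f i)) \<le> ln (\<Prod>j\<in>I - {i}. fact_root (card (S j - {f i})))"
        by simp
      also have "\<dots> = (\<Sum>j\<in>I - {i}. ln (fact_root (card (S j - {f i}))))"
        using Suc.prems by (intro ln_prod less_imp_neq[THEN not_sym] pos) auto
      finally show ?thesis .
    qed
    have "real n * (P * ln P) \<le> (\<Sum>i\<in>I. \<Sum>f\<in>F. ln (real (card (S i))) + ln (Q i (f i)))"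
      using sum_mono[of I "\<lambda>_. P * ln P", OF row] by (simp add: n_def)
    also have "\<dots> = (\<Sum>f\<in>F. (\<Sum>i\<in>I. ln (real (card (S i)))) + (\<Sum>i\<in>I. ln (Q i (f i))))"
      by (subst sum.swap) (simp add: sum.distrib)
    also have "\<dots> \<le> (\<Sum>f\<in>F. real n * (\<Sum>j\<in>I. ln (fact_root (card (S j)))))"
    proof (rule sum_mono)
      fix f assume f: "f \<in> F"
      have "(\<Sum>i\<in>I. ln (Q i (f i))) \<le> (\<Sum>i\<in>I. \<Sum>j\<in>I - {i}. ln (fact_root (card (S j - {f i}))))"
        using minor[OF f] by (rule sum_mono)
      \<comment> \<open>The symmetric condition on \<open>i\<close> and \<open>j\<close> permits
        exchanging the sums, which collects all contributions to one row \<open>j\<close>.\<close>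
      also have "\<dots> = (\<Sum>i\<in>I. \<Sum>j | j \<in> I \<and> i \<noteq> j. ln (fact_root (card (S j - {f i}))))"
        by (intro sum.cong) auto
      also have "\<dots> = (\<Sum>j\<in>I. \<Sum>i | i \<in> I \<and> i \<noteq> j. ln (fact_root (card (S j - {f i}))))"
        using Suc.prems by (intro sum.swap_restrict) auto
      also have "\<dots> = (\<Sum>j\<in>I. \<Sum>i\<in>I - {j}. ln (fact_root (card (S j - {f i}))))"
        by (intro sum.cong) auto
      finally have "(\<Sum>i\<in>I. ln (real (card (S i)))) + (\<Sum>i\<in>I. ln (Q i (f i)))
        \<le> (\<Sum>j\<in>I. ln (real (card (S j))) + (\<Sum>i\<in>I - {j}. ln (fact_root (card (S j - {f i})))))"
        by (simp add: sum.distrib)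
      also have "\<dots> = (\<Sum>j\<in>I. real n * ln (fact_root (card (S j))))"
        unfolding n_def using Suc.prems f
        by (intro sum.cong refl sum_ln_fact_root_deleted) (auto simp: F_def)
      finally show "(\<Sum>i\<in>I. ln (real (card (S i)))) + (\<Sum>i\<in>I. ln (Q i (f i)))
        \<le> real n * (\<Sum>j\<in>I. ln (fact_root (card (S j))))"
        by (simp add: sum_distrib_left)
    qed
    also have "\<dots> = real n * (P * (\<Sum>j\<in>I. ln (fact_root (card (S j)))))"
      by (simp add: P_def)
    finally have "ln P \<le> (\<Sum>j\<in>I. ln (fact_root (card (S j))))"
      using n P by simp
    also have "\<dots> = ln (\<Prod>j\<in>I. fact_root (card (S j)))"
      using Suc.prems by (intro ln_prod[symmetric] less_imp_neq[THEN not_sym] fact_root_pos S_pos) auto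
    finally have "P \<le> (\<Prod>j\<in>I. fact_root (card (S j)))"
      using P S_pos by (subst (asm) ln_le_cancel_iff) (auto intro!: prod_pos fact_root_pos)
    then show ?thesis by (simp add: P_def F_def)
  qed
qed

section \<open>Diagonals as sequences of permutations\<close>

text \<open>\<open>h j\<close> is the permutation giving the j-th indices. Taking \<open>h 1\<close>
  to be the identity labels the elements of the diagonal by their hyperplanes. Extendability to a
  one of \<open>A\<close> is asked for each \<open>i\<close> separately, so the extensions need not
  form a diagonal; at \<open>m = d\<close> it says that all n entries are ones.\<close>

definition partial_diagonals ::
    "nat \<Rightarrow> nat \<Rightarrow> ((nat \<Rightarrow> nat) \<Rightarrow> real) \<Rightarrow> nat \<Rightarrow> (nat \<Rightarrow> nat \<Rightarrow> nat) set" where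
  "partial_diagonals n d A m = {h \<in> {1..m} \<rightarrow>\<^sub>E ({1..n} \<rightarrow>\<^sub>E {1..n}).
     (\<forall>i\<in>{1..n}. h 1 i = i) \<and> (\<forall>j\<in>{1..m}. bij_betw (h j) {1..n} {1..n}) \<and>
     (\<forall>i\<in>{1..n}. \<exists>\<alpha>\<in>multi_indices n d. A \<alpha> = 1 \<and> (\<forall>j\<in>{1..m}. \<alpha> j = h j i))}"

lemma finite_multi_indices: "finite (multi_indices n d)"
  by (simp add: multi_indices_def finite_PiE)

lemma finite_partial_diagonals: "finite (partial_diagonals n d A m)"
  by (rule finite_subset[of _ "{1..m} \<rightarrow>\<^sub>E ({1..n} \<rightarrow>\<^sub>E {1..n})"])
     (auto simp: partial_diagonals_def intro!: finite_PiE)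

lemma finite_diagonals: "finite (diagonals n d)"
  by (rule finite_subset[of _ "Pow (multi_indices n d)"])
     (auto simp: diagonals_def finite_multi_indices)

lemma diagonal_bij_betw:
  assumes p: "p \<in> diagonals n d" and j: "j \<in> {1..d}"
  shows "bij_betw (\<lambda>\<alpha>. \<alpha> j) p {1..n}"
proof -
  have inj: "inj_on (\<lambda>\<alpha>. \<alpha> j) p"
    using p j unfolding diagonals_def inj_on_def by blast
  moreover have "(\<lambda>\<alpha>. \<alpha> j) ` p \<subseteq> {1..n}"
    using p j by (fastforce simp: diagonals_def multi_indices_def PiE_def)
  moreover have "card ((\<lambda>\<alpha>. \<alpha> j) ` p) = n"
    using inj p by (simp add: card_image diagonals_def)
  ultimately have "(\<lambda>\<alpha>. \<alpha> j) ` p = {1..n}"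
    by (intro card_subset_eq) auto
  with inj show ?thesis by (simp add: bij_betw_def)
qed

text \<open>List \<open>p\<close> by first index, through the inverse \<open>a\<close> of the first
  coordinate on \<open>p\<close>. The j-th coordinates of this list form the permutation
  \<open>h j\<close>.\<close>

lemma diagonal_of_ones_in_image:
  assumes d: "1 \<le> d" and p: "p \<in> diagonals n d" and ones: "\<forall>\<alpha>\<in>p. A \<alpha> = 1"
  shows "p \<in> (\<lambda>h. (\<lambda>i. \<lambda>j\<in>{1..d}. h j i) ` {1..n}) ` partial_diagonals n d A d"
proof
  define a where "a = inv_into p (\<lambda>\<alpha>. \<alpha> 1)"
  define h where "h = (\<lambda>j\<in>{1..d}. \<lambda>i\<in>{1..n}. a i j)"
  have bij1: "bij_betw (\<lambda>\<alpha>. \<alpha> 1) p {1..n}"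
    using diagonal_bij_betw[OF p] d by simp
  have a: "bij_betw a {1..n} p"
    unfolding a_def by (rule bij_betw_inv_into[OF bij1])
  have ap: "a i \<in> p" if "i \<in> {1..n}" for i
    using a that by (auto simp: bij_betw_def)
  have a1: "a i 1 = i" if "i \<in> {1..n}" for i
    using f_inv_into_f[of i "\<lambda>\<alpha>. \<alpha> 1" p] bij1 that by (simp add: a_def bij_betw_def)
  have pm: "p \<subseteq> multi_indices n d" using p by (simp add: diagonals_def)
  have bij: "bij_betw (h j) {1..n} {1..n}" if j: "j \<in> {1..d}" for j
  proof -
    have "bij_betw (\<lambda>i. a i j) {1..n} {1..n}"
      using bij_betw_trans[OF a diagonal_bij_betw[OF p j]] by (simp add: o_def)
    moreover have "h j = (\<lambda>i\<in>{1..n}. a i j)" using j by (simp add: h_def)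
    ultimately show ?thesis by (simp del: restrict_apply)
  qed
  show "h \<in> partial_diagonals n d A d"
    unfolding partial_diagonals_def
  proof (intro CollectI conjI ballI)
    show "h \<in> {1..d} \<rightarrow>\<^sub>E ({1..n} \<rightarrow>\<^sub>E {1..n})"
      using ap pm by (fastforce simp: h_def multi_indices_def)
    show "h 1 i = i" if "i \<in> {1..n}" for i using that a1[OF that] d by (simp add: h_def)
    show "\<exists>\<alpha>\<in>multi_indices n d. A \<alpha> = 1 \<and> (\<forall>j\<in>{1..d}. \<alpha> j = h j i)" if "i \<in> {1..n}" for i
      using ap[OF that] that pm ones by (intro bexI[of _ "a i"]) (auto simp: h_def)
  qed (use bij in auto)
  have "(\<lambda>j\<in>{1..d}. h j i) = a i" if "i \<in> {1..n}" for i
    using that subsetD[OF pm ap[OF that]]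
    by (intro extensionalityI[of _ "{1..d}"]) (auto simp: h_def multi_indices_def PiE_def)
  then show "p = (\<lambda>i. \<lambda>j\<in>{1..d}. h j i) ` {1..n}"
    using a by (auto simp: bij_betw_def)
qed

text \<open>A diagonal meeting a zero contributes 0 and every other one contributes 1, so the
  permanent counts the diagonals of ones.\<close>

lemma permanent_le_card_partial_diagonals:
  assumes "1 \<le> d" "zero_one_matrix n d A"
  shows "permanent n d A \<le> real (card (partial_diagonals n d A d))"
proof -
  have "permanent n d A = (\<Sum>p\<in>{p \<in> diagonals n d. \<forall>\<alpha>\<in>p. A \<alpha> = 1}. \<Prod>\<alpha>\<in>p. A \<alpha>)"
    unfolding permanent_def
  proof (rule sum.mono_neutral_right)
    show "\<forall>p\<in>diagonals n d - {p \<in> diagonals n d. \<forall>\<alpha>\<in>p. A \<alpha> = 1}. (\<Prod>\<alpha>\<in>p. A \<alpha>) = 0"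
    proof
      fix p assume p: "p \<in> diagonals n d - {p \<in> diagonals n d. \<forall>\<alpha>\<in>p. A \<alpha> = 1}"
      then have sub: "p \<subseteq> multi_indices n d" by (simp add: diagonals_def)
      then have "finite p" using finite_multi_indices finite_subset by blast
      moreover have "\<exists>\<alpha>\<in>p. A \<alpha> = 0" using p sub assms(2) unfolding zero_one_matrix_def by blast
      ultimately show "(\<Prod>\<alpha>\<in>p. A \<alpha>) = 0" by (simp add: prod_zero)
    qed
  qed (auto simp: finite_diagonals)
  also have "\<dots> = real (card {p \<in> diagonals n d. \<forall>\<alpha>\<in>p. A \<alpha> = 1})" by simp
  also have "\<dots> \<le> real (card (partial_diagonals n d A d))"
    using diagonal_of_ones_in_image[OF assms(1)]
    by (intro of_nat_mono surj_card_le[OF finite_partial_diagonals]) blast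
  finally show ?thesis .
qed

section \<open>Choosing the permutations one index at a time\<close>

text \<open>For fixed \<open>h\<close> these are the row supports to which Bregman's theorem is
  applied.\<close>

definition next_values ::
    "nat \<Rightarrow> nat \<Rightarrow> ((nat \<Rightarrow> nat) \<Rightarrow> real) \<Rightarrow> nat \<Rightarrow> (nat \<Rightarrow> nat \<Rightarrow> nat) \<Rightarrow> nat \<Rightarrow> nat set" where
  "next_values n d A m h i =
     (\<lambda>\<alpha>. \<alpha> (Suc m)) ` {\<alpha> \<in> multi_indices n d. A \<alpha> = 1 \<and> (\<forall>j\<in>{1..m}. \<alpha> j = h j i)}"

text \<open>Split \<open>h\<close> into its first \<open>m\<close> permutations and the last one.
  The ones of \<open>A\<close> extending the longer prefixes also extend the shorter ones, and show
  that the last permutation takes admissible values.\<close>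

lemma card_partial_diagonals_Suc_le:
  assumes m: "1 \<le> m"
  shows "card (partial_diagonals n d A (Suc m))
    \<le> (\<Sum>h\<in>partial_diagonals n d A m.
         card (bijections_within {1..n} {1..n} (next_values n d A m h)))"
proof -
  let ?T = "partial_diagonals n d A" and ?B = "\<lambda>h. bijections_within {1..n} {1..n} (next_values n d A m h)"
  let ?\<phi> = "\<lambda>h. (restrict h {1..m}, h (Suc m))"
  have "card (?T (Suc m)) \<le> card (Sigma (?T m) ?B)"
  proof (rule card_inj_on_le)
    show "inj_on ?\<phi> (?T (Suc m))"
    proof (rule inj_onI)
      fix h g assume *: "h \<in> ?T (Suc m)" "g \<in> ?T (Suc m)" and eq: "?\<phi> h = ?\<phi> g"
      have eq': "restrict h {1..m} j = restrict g {1..m} j" "h (Suc m) = g (Suc m)" for j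
        using eq by auto
      show "h = g"
      proof (rule extensionalityI[of _ "{1..Suc m}"])
        fix j assume "j \<in> {1..Suc m}"
        then show "h j = g j" using eq'(1)[of j] eq'(2) by (cases "j = Suc m") auto
      qed (use * in \<open>auto simp: partial_diagonals_def PiE_def\<close>)
    qed
    show "?\<phi> ` ?T (Suc m) \<subseteq> Sigma (?T m) ?B"
    proof (rule image_subsetI)
      fix h assume h: "h \<in> ?T (Suc m)"
      have one: "\<exists>\<alpha>\<in>multi_indices n d. A \<alpha> = 1 \<and> (\<forall>j\<in>{1..Suc m}. \<alpha> j = h j i)" if "i \<in> {1..n}" for i
        using h that by (simp add: partial_diagonals_def)
      have "restrict h {1..m} \<in> ?T m"
        \<comment> \<open>\<open>1 \<le> m\<close> keeps position 1 in the restriction, so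
          \<open>h 1\<close> is still the identity.\<close>
        using h m unfolding partial_diagonals_def by (auto simp: PiE_iff) fastforce+
      moreover have "h (Suc m) i \<in> next_values n d A m (restrict h {1..m}) i" if i: "i \<in> {1..n}" for i
      proof -
        obtain \<alpha> where "\<alpha> \<in> multi_indices n d" "A \<alpha> = 1" "\<forall>j\<in>{1..Suc m}. \<alpha> j = h j i"
          using one[OF i] by blast
        then show ?thesis unfolding next_values_def by (intro image_eqI[of _ _ \<alpha>]) auto
      qed
      then have "h (Suc m) \<in> ?B (restrict h {1..m})"
        using h by (auto simp: bijections_within_def partial_diagonals_def PiE_iff)
      ultimately show "?\<phi> h \<in> Sigma (?T m) ?B" by simp
    qed
    show "finite (Sigma (?T m) ?B)"
      by (auto intro!: finite_SigmaI finite_partial_diagonals finite_bijections_within)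
  qed
  also have "\<dots> = (\<Sum>h\<in>?T m. card (?B h))"
    by (simp add: finite_partial_diagonals finite_bijections_within)
  finally show ?thesis .
qed

text \<open>Each covering plane contributes only one value of \<open>f\<close>.\<close>

lemma card_image_le_if_coverable_by:
  assumes cov: "coverable_by s \<L> X" and const: "\<And>P x y. P \<in> \<L> \<Longrightarrow> x \<in> P \<Longrightarrow> y \<in> P \<Longrightarrow> f x = f y"
  shows "card (f ` X) \<le> s"
proof -
  obtain \<C> where C: "\<C> \<subseteq> \<L>" "finite \<C>" "card \<C> \<le> s" "X \<subseteq> \<Union>\<C>"
    using cov by (auto simp: coverable_by_def)
  have "f ` X \<subseteq> (\<lambda>P. f (SOME x. x \<in> P)) ` \<C>"
  proof (rule image_subsetI)
    fix x assume "x \<in> X"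
    then obtain P where P: "P \<in> \<C>" "x \<in> P" using C by blast
    then have "f x = f (SOME x. x \<in> P)"
      using const[of P x] C(1) someI[of "\<lambda>x. x \<in> P" x] by blast
    then show "f x \<in> (\<lambda>P. f (SOME x. x \<in> P)) ` \<C>" using P by blast
  qed
  then have "card (f ` X) \<le> card \<C>"
    using C by (meson surj_card_le)
  with C show ?thesis by simp
qed

text \<open>The prefix fixes \<open>m\<close> indices, hence a plane of dimension
  \<open>d - m\<close>. The planes covering its ones also fix index \<open>m + 1\<close>, so each
  allows one value. In dimension 1 there is no smaller plane, and the number of ones is the
  bound.\<close>

lemma card_next_values_le:
  assumes m: "1 \<le> m" "m < d"
    and h: "h \<in> partial_diagonals n d A m" and i: "i \<in> {1..n}"
    and cover: "\<And>k P. \<lbrakk>2 \<le> k; k \<le> d - 1; P \<in> last_planes n d k i\<rbrakk> \<Longrightarrow>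
           coverable_by (s k) (last_planes n d (k - 1) i) (ones_in A P)"
    and lines: "\<And>P. P \<in> last_planes n d 1 i \<Longrightarrow> card (ones_in A P) \<le> s 1"
  shows "card (next_values n d A m h i) \<le> s (d - m)"
proof -
  \<comment> \<open>A plane in \<open>last_planes\<close> is given by a full multi-index, so a one
    of \<open>A\<close> extending the prefix serves as its base point; its first index is
    \<open>i\<close> because \<open>h 1\<close> is the identity.\<close>
  obtain \<beta> where \<beta>: "\<beta> \<in> multi_indices n d" "\<forall>j\<in>{1..m}. \<beta> j = h j i"
    using h i unfolding partial_diagonals_def by blast
  have "\<beta> 1 = i" using \<beta>(2) h i m by (simp add: partial_diagonals_def)
  define P where "P = plane n d {1..d - (d - m)} \<beta>"
  have P: "P \<in> last_planes n d (d - m) i"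
    unfolding P_def last_planes_def using \<beta> \<open>\<beta> 1 = i\<close> by blast
  have values_eq: "next_values n d A m h i = (\<lambda>\<alpha>. \<alpha> (Suc m)) ` ones_in A P"
    unfolding next_values_def P_def ones_in_def plane_def using \<beta> m
    by (intro arg_cong[where f = "image _"]) auto
  show ?thesis
  proof (cases "d - m = 1")
    case True
    have "finite (ones_in A P)"
      by (rule finite_subset[OF _ finite_multi_indices]) (auto simp: ones_in_def P_def plane_def)
    then have "card (next_values n d A m h i) \<le> card (ones_in A P)"
      unfolding values_eq by (rule card_image_le)
    also have "\<dots> \<le> s (d - m)" using lines P True by simp
    finally show ?thesis .
  next
    case False
    \<comment> \<open>Planes of dimension \<open>d - m - 1\<close> thus fix exactly the positions up
      to \<open>m + 1\<close>.\<close>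
    have "d - (d - m - 1) = Suc m" using m by simp
    then have "\<alpha> (Suc m) = \<alpha>' (Suc m)"
      if "Q \<in> last_planes n d (d - m - 1) i" "\<alpha> \<in> Q" "\<alpha>' \<in> Q" for Q \<alpha> \<alpha>'
      using that by (auto simp: last_planes_def plane_def)
    moreover have "coverable_by (s (d - m)) (last_planes n d (d - m - 1) i) (ones_in A P)"
      using False m P by (intro cover) auto
    ultimately show ?thesis
      unfolding values_eq by (intro card_image_le_if_coverable_by) auto
  qed
qed

theorem theorem3:
  fixes n d :: nat
    and A :: "(nat \<Rightarrow> nat) \<Rightarrow> real"
    and s :: "nat \<Rightarrow> nat \<Rightarrow> nat"
  assumes "n \<ge> 1" and "d \<ge> 2"
    and "zero_one_matrix n d A"
    and "\<And>i k P. \<lbrakk>i \<in> {1..n}; 2 \<le> k; k \<le> d - 1; P \<in> last_planes n d k i\<rbrakk> \<Longrightarrow>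
           coverable_by (s i k) (last_planes n d (k - 1) i) (ones_in A P)"
    and "\<And>i P. \<lbrakk>i \<in> {1..n}; P \<in> last_planes n d 1 i\<rbrakk> \<Longrightarrow> card (ones_in A P) \<le> s i 1"
  shows "permanent n d A \<le> (\<Prod>k = 1..d - 1. \<Prod>i = 1..n. fact_root (s i k))"
proof -
  let ?T = "partial_diagonals n d A"
  \<comment> \<open>Choosing the permutation for index \<open>m + 1\<close> costs the factor k = d -
    m, so the product grows downwards from k = d - 1. At \<open>m = 1\<close> only the identity is
    possible and the product is empty; at \<open>m = d\<close> it is the full bound.\<close>
  have "m \<le> d \<Longrightarrow> real (card (?T m)) \<le> (\<Prod>k\<in>{d - m + 1..d - 1}. \<Prod>i = 1..n. fact_root (s i k))"
    if "1 \<le> m" for m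
    using that
  proof (induction m rule: dec_induct)
    case base
    have "?T 1 \<subseteq> {\<lambda>j\<in>{1}. \<lambda>i\<in>{1..n}. i}"
    proof
      fix h assume h: "h \<in> ?T 1"
      have "h 1 = (\<lambda>i\<in>{1..n}. i)"
        using h by (intro extensionalityI[of _ "{1..n}"]) (auto simp: partial_diagonals_def PiE_iff)
      then have "h = (\<lambda>j\<in>{1}. \<lambda>i\<in>{1..n}. i)"
        using h by (intro PiE_ext[of h "{1}" "\<lambda>_. UNIV"]) (auto simp: partial_diagonals_def PiE_iff)
      then show "h \<in> {\<lambda>j\<in>{1}. \<lambda>i\<in>{1..n}. i}" by simp
    qed
    then have "card (?T 1) \<le> 1"
      using card_mono[of "{\<lambda>j\<in>{1::nat}. \<lambda>i\<in>{1..n}. i}" "?T 1"] by simp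
    then show ?case using assms(2) by simp
  next
    case (step m)
    let ?b = "\<Prod>i = 1..n. fact_root (s i (d - m))"
    have "real (card (bijections_within {1..n} {1..n} (next_values n d A m h))) \<le> ?b" if h: "h \<in> ?T m" for h
    proof -
      \<comment> \<open>Here \<open>Suc m \<le> d\<close>, so the value read off is a genuine
        index.\<close>
      have "next_values n d A m h i \<subseteq> {1..n}" for i
        using step by (auto simp: next_values_def multi_indices_def PiE_iff)
      then have "real (card (bijections_within {1..n} {1..n} (next_values n d A m h)))
        \<le> (\<Prod>i = 1..n. fact_root (card (next_values n d A m h i)))"
        by (intro Bregman) auto
      also have "\<dots> \<le> ?b"
        using step h assms(4,5)
        by (intro prod_mono conjI fact_root_nonneg monoD[OF mono_fact_root] card_next_values_le) auto
      finally show ?thesis .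
    qed
    then have "(\<Sum>h\<in>?T m. real (card (bijections_within {1..n} {1..n} (next_values n d A m h))))
      \<le> real (card (?T m)) * ?b"
      by (rule sum_bounded_above)
    moreover have "real (card (?T (Suc m)))
      \<le> (\<Sum>h\<in>?T m. real (card (bijections_within {1..n} {1..n} (next_values n d A m h))))"
      using card_partial_diagonals_Suc_le[OF step.hyps(1), of n d A]
      by (metis of_nat_le_iff of_nat_sum)
    ultimately have "real (card (?T (Suc m))) \<le> real (card (?T m)) * ?b"
      by linarith
    also have "\<dots> \<le> (\<Prod>k\<in>{d - m + 1..d - 1}. \<Prod>i = 1..n. fact_root (s i k)) * ?b"
      using step by (intro mult_right_mono prod_nonneg) (auto simp: fact_root_nonneg)
    also have "\<dots> = (\<Prod>k\<in>insert (d - m) {d - m + 1..d - 1}. \<Prod>i = 1..n. fact_root (s i k))"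
      by simp
    also have "insert (d - m) {d - m + 1..d - 1} = {d - Suc m + 1..d - 1}"
      using step by auto
    finally show ?case .
  qed
  from this[of d] have "real (card (?T d)) \<le> (\<Prod>k = 1..d - 1. \<Prod>i = 1..n. fact_root (s i k))"
    using assms(2) by simp
  moreover have "permanent n d A \<le> real (card (?T d))"
    using assms(2,3) by (intro permanent_le_card_partial_diagonals) auto
  ultimately show ?thesis by linarith
qed

end
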